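(* The point $\ast$ has no countable neighborhood base in the ERI space $X=(X_0,\tau_{\mathrm{ERI}})$. In particular, $X$ is neither first-countable nor second-countable.
   Context: Let $\overline{\mathbb{R}}=[-\infty,+\infty]$ be the extended real line with its order topology. Let $\sim$ be the equivalence relation on $\overline{\mathbb{R}}$ whose only non-singleton class is $\{-\infty,0,+\infty\}$, let $X_0=\overline{\mathbb{R}}/{\sim}$ be the quotient set, $q\colon\overline{\mathbb{R}}\to X_0$ the projection, and $\ast=q(-\infty)=q(0)=q(+\infty)$. The ERI topology $\tau_{\mathrm{ERI}}$ on $X_0$ consists of all $U\subseteq X_0$ such that (a) $q^{-1}(U)$ is open in $\overline{\mathbb{R}}$, and (b) if $\ast\in U$ then $q^{-1}(U)$ is dense in $\overline{\mathbb{R}}$. (This is a topology.) The ERI space is $X=(X_0,\tau_{\mathrm{ERI}})$. *)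

theory Defs
  imports "HOL-Analysis.Analysis"
begin

definition eri_rel :: "(ereal \<times> ereal) set" where
  "eri_rel = {(x, y). x = y \<or> (x \<in> {-\<infinity>, 0, \<infinity>} \<and> y \<in> {-\<infinity>, 0, \<infinity>})}"

lemma equiv_eri_rel: "equiv UNIV eri_rel"
  by (rule equivI) (auto simp: eri_rel_def refl_on_def sym_def trans_def)

definition eri_carrier :: "ereal set set" where
  "eri_carrier = UNIV // eri_rel"

definition eri_proj :: "ereal \<Rightarrow> ereal set" where
  "eri_proj x = eri_rel `` {x}"

definition eri_star :: "ereal set" where
  "eri_star = eri_proj 0"

lemma eri_star_eq: "eri_proj (-\<infinity>) = eri_star" "eri_proj \<infinity> = eri_star"
  by (auto simp: eri_star_def eri_proj_def eri_rel_def)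

lemma eri_proj_eq_iff: "eri_proj x = eri_proj y \<longleftrightarrow> (x, y) \<in> eri_rel"
  unfolding eri_proj_def by (simp add: eq_equiv_class_iff[OF equiv_eri_rel])

lemma eri_carrier_eq: "eri_carrier = range eri_proj"
  by (auto simp: eri_carrier_def eri_proj_def quotient_def)

definition eri_open :: "ereal set set \<Rightarrow> bool" where
  "eri_open U \<longleftrightarrow> U \<subseteq> eri_carrier \<and> open (eri_proj -` U) \<and>
     (eri_star \<in> U \<longrightarrow> closure (eri_proj -` U) = UNIV)"

lemma istopology_eri_open: "istopology eri_open"
  unfolding istopology_def
proof (intro conjI allI impI)
  fix S T assume S: "eri_open S" and T: "eri_open T"
  have "closure (eri_proj -` S \<inter> eri_proj -` T) = UNIV" if "eri_star \<in> S \<inter> T"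
  proof -
    have "open (eri_proj -` S)" "closure (eri_proj -` S) = UNIV" "closure (eri_proj -` T) = UNIV"
      using S T that by (auto simp: eri_open_def)
    then have "eri_proj -` S \<subseteq> closure (eri_proj -` S \<inter> eri_proj -` T)"
      using open_Int_closure_subset[of "eri_proj -` S" "eri_proj -` T"] by simp
    then have "closure (eri_proj -` S) \<subseteq> closure (eri_proj -` S \<inter> eri_proj -` T)"
      by (simp add: closure_minimal)
    then show ?thesis
      using \<open>closure (eri_proj -` S) = UNIV\<close> by auto
  qed
  then show "eri_open (S \<inter> T)"
    using S T by (auto simp: eri_open_def)
next
  fix K assume K: "\<forall>S\<in>K. eri_open S"
  have "closure (eri_proj -` \<Union>K) = UNIV" if "eri_star \<in> \<Union>K"
  proof -
    from that obtain S where S: "S \<in> K" "eri_star \<in> S" by blast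
    then have "closure (eri_proj -` S) = UNIV"
      using K by (auto simp: eri_open_def)
    moreover have "closure (eri_proj -` S) \<subseteq> closure (eri_proj -` \<Union>K)"
      using S by (intro closure_mono) auto
    ultimately show ?thesis by auto
  qed
  moreover have "open (eri_proj -` \<Union>K)"
    using K by (auto simp: eri_open_def vimage_Union)
  moreover have "\<Union>K \<subseteq> eri_carrier"
    using K by (auto simp: eri_open_def)
  ultimately show "eri_open (\<Union>K)"
    by (simp add: eri_open_def)
qed

definition eri_space :: "ereal set topology" where
  "eri_space = topology eri_open"

lemma openin_eri_space: "openin eri_space = eri_open"
  by (simp add: eri_space_def istopology_eri_open)

lemma topspace_eri_space: "topspace eri_space = eri_carrier"
proof -
  have "eri_proj -` eri_carrier = UNIV"
    by (auto simp: eri_carrier_eq)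
  then have "openin eri_space eri_carrier"
    by (simp add: openin_eri_space eri_open_def)
  moreover have "topspace eri_space \<subseteq> eri_carrier"
    using openin_topspace[of eri_space] unfolding openin_eri_space eri_open_def by blast
  ultimately show ?thesis
    by (simp add: openin_subset subset_antisym)
qed

text \<open>Neighbourhoods need not be open.\<close>

definition neighbourhood_in :: "'a topology \<Rightarrow> 'a \<Rightarrow> 'a set \<Rightarrow> bool" where
  "neighbourhood_in X x N \<longleftrightarrow> N \<subseteq> topspace X \<and> (\<exists>U. openin X U \<and> x \<in> U \<and> U \<subseteq> N)"

definition neighbourhood_base_in :: "'a topology \<Rightarrow> 'a \<Rightarrow> 'a set set \<Rightarrow> bool" where
  "neighbourhood_base_in X x \<B> \<longleftrightarrow>
     (\<forall>N\<in>\<B>. neighbourhood_in X x N) \<and>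
     (\<forall>M. neighbourhood_in X x M \<longrightarrow> (\<exists>N\<in>\<B>. N \<subseteq> M))"

lemma neighbourhood_base_in_iff:
  "neighbourhood_base_in X x \<B> \<longleftrightarrow>
     (\<forall>N\<in>\<B>. neighbourhood_in X x N) \<and> neighbourhood_base_at x (\<lambda>N. N \<in> \<B>) X"
proof
  assume L: "neighbourhood_base_in X x \<B>"
  have "\<exists>U V. openin X U \<and> V \<in> \<B> \<and> x \<in> U \<and> U \<subseteq> V \<and> V \<subseteq> W" if "openin X W" "x \<in> W" for W
  proof -
    have "neighbourhood_in X x W"
      using that openin_subset by (auto simp: neighbourhood_in_def)
    then obtain V where "V \<in> \<B>" "V \<subseteq> W"
      using L by (auto simp: neighbourhood_base_in_def)
    moreover from this obtain U where "openin X U" "x \<in> U" "U \<subseteq> V"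
      using L by (auto simp: neighbourhood_base_in_def neighbourhood_in_def)
    ultimately show ?thesis by blast
  qed
  with L show "(\<forall>N\<in>\<B>. neighbourhood_in X x N) \<and> neighbourhood_base_at x (\<lambda>N. N \<in> \<B>) X"
    by (auto simp: neighbourhood_base_in_def neighbourhood_base_at_def)
next
  assume R: "(\<forall>N\<in>\<B>. neighbourhood_in X x N) \<and> neighbourhood_base_at x (\<lambda>N. N \<in> \<B>) X"
  have "\<exists>N\<in>\<B>. N \<subseteq> M" if M: "neighbourhood_in X x M" for M
  proof -
    from M obtain W where "openin X W" "x \<in> W" "W \<subseteq> M"
      by (auto simp: neighbourhood_in_def)
    with R obtain V where "V \<in> \<B>" "V \<subseteq> W"
      unfolding neighbourhood_base_at_def by blast
    with \<open>W \<subseteq> M\<close> show ?thesis by blast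
  qed
  with R show "neighbourhood_base_in X x \<B>"
    by (simp add: neighbourhood_base_in_def)
qed

end

theory Submission
  imports Defs
begin

text \<open>Given open neighbourhoods \<open>U\<^sub>n\<close> of the special point, density lets us pick a real
  \<open>t\<^sub>n\<close> in the preimage of \<open>U\<^sub>n\<close> with \<open>1 < t\<^sub>n < 1 + 1/(n+1)\<close>. The set consisting of \<open>1\<close> and all
  \<open>t\<^sub>n\<close> is compact and countable, so its complement is open and dense; the image of this
  complement is a neighbourhood of the special point that contains no \<open>U\<^sub>n\<close>. The points must
  accumulate at a removed point: the extended line is compact, and removing points that
  accumulate only at infinity would not leave an open set.\<close>

text \<open>An open subset of the image of \<open>T\<close> has no infinite point, so if nonempty it
  pulls back to a nonempty open set of reals inside \<open>T\<close>, which would be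
  uncountable.\<close>

lemma dense_Compl_ereal_image_countable:
  assumes "countable T"
  shows "closure (- (ereal ` T)) = UNIV"
proof -
  have "interior (ereal ` T) = {}"
  proof (rule ccontr)
    assume ne: "interior (ereal ` T) \<noteq> {}"
    define V where "V = ereal -` interior (ereal ` T)"
    have "open V"
      unfolding V_def by (rule open_ereal_vimage) simp
    moreover have "V \<subseteq> T"
      using interior_subset[of "ereal ` T"] by (auto simp: V_def)
    moreover have "V \<noteq> {}"
      using ne interior_subset[of "ereal ` T"] by (auto simp: V_def)
    ultimately show False
      using open_minus_countable[of T V] assms by blast
  qed
  then show ?thesis
    by (simp add: closure_interior)
qed

text \<open>Away from the glued class every equivalence class is a singleton, so \<open>S\<close> is
  saturated.\<close>

lemma eri_proj_vimage_image:
  assumes "S \<inter> {-\<infinity>, 0, \<infinity>} = {}"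
  shows "eri_proj -` (eri_proj ` S) = S"
  using assms by (auto simp: eri_proj_eq_iff eri_rel_def)

lemma eri_open_Diff_countable_compact:
  assumes "countable T" "compact T" "0 \<notin> T"
  shows "eri_open (eri_carrier - eri_proj ` ereal ` T)"
proof -
  have "eri_proj -` (eri_carrier - eri_proj ` ereal ` T)
      = - (eri_proj -` (eri_proj ` ereal ` T))"
    by (auto simp: eri_carrier_eq)
  also have "\<dots> = - (ereal ` T)"
    using assms by (subst eri_proj_vimage_image) auto
  finally have vimage: "eri_proj -` (eri_carrier - eri_proj ` ereal ` T) = - (ereal ` T)" .
  \<comment> \<open>Closedness of \<open>T\<close> in the reals would not suffice: an unbounded
    \<open>T\<close> accumulates at an infinite point. Compactness survives the embedding.\<close>
  have "closed (ereal ` T)"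
    using assms by (intro compact_imp_closed compact_continuous_image) (auto intro: continuous_on_ereal)
  then show ?thesis
    using dense_Compl_ereal_image_countable[OF assms(1)]
    unfolding eri_open_def vimage by auto
qed

lemma eri_star_notin_image:
  assumes "0 \<notin> T"
  shows "eri_star \<notin> eri_proj ` ereal ` T"
  using assms by (auto simp: eri_star_def eri_proj_eq_iff eri_rel_def zero_ereal_def)

lemma eri_open_star_meets_interval:
  assumes "eri_open U" "eri_star \<in> U" "a < b"
  obtains t where "a < t" "t < b" "eri_proj (ereal t) \<in> U"
proof -
  have "{ereal a<..<ereal b} \<inter> closure (eri_proj -` U) \<noteq> {}"
    using assms dense[of "ereal a" "ereal b"] by (auto simp: eri_open_def)
  then obtain y where "ereal a < y" "y < ereal b" "eri_proj y \<in> U"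
    using open_Int_closure_eq_empty[of "{ereal a<..<ereal b}" "eri_proj -` U"] by auto
  \<comment> \<open>A point strictly between two reals is finite.\<close>
  then show thesis
    by (cases y) (auto intro: that)
qed

lemma eri_open_star_containing_no_member:
  fixes U :: "nat \<Rightarrow> ereal set set"
  assumes U: "\<And>n. eri_open (U n)" "\<And>n. eri_star \<in> U n"
  obtains M where "eri_open M" "eri_star \<in> M" "\<And>n. \<not> U n \<subseteq> M"
proof -
  \<comment> \<open>\<open>Suc n\<close> keeps the interval nonempty at \<open>n = 0\<close>, where
    \<open>1 / 0 = 0\<close> would collapse it.\<close>
  have "\<exists>t. 1 < t \<and> t < 1 + 1 / real (Suc n) \<and> eri_proj (ereal t) \<in> U n" for n
    by (rule eri_open_star_meets_interval[OF U, of 1 "1 + 1 / real (Suc n)" n]) auto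
  then obtain t where t: "\<And>n. 1 < t n" "\<And>n. t n < 1 + 1 / real (Suc n)"
      "\<And>n. eri_proj (ereal (t n)) \<in> U n"
    by metis
  have "(\<lambda>n. 1 + 1 / real (Suc n)) \<longlonglongrightarrow> 1 + 0"
    by (intro tendsto_intros LIMSEQ_Suc[OF lim_1_over_n])
  then have "t \<longlonglongrightarrow> 1"
    using t by (intro tendsto_sandwich[of "\<lambda>_. 1" t sequentially "\<lambda>n. 1 + 1 / real (Suc n)"])
      (auto intro!: always_eventually less_imp_le)
  then have compact: "compact (insert 1 (range t))"
    by (rule compact_sequence_with_limit)
  have nonzero: "0 \<notin> insert 1 (range t)"
  proof
    assume "0 \<in> insert 1 (range t)"
    then obtain n where "t n = 0" by auto
    with t(1)[of n] show False by simp
  qed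
  define M where "M = eri_carrier - eri_proj ` ereal ` insert 1 (range t)"
  show thesis
  proof
    show "eri_open M"
      unfolding M_def using compact nonzero by (intro eri_open_Diff_countable_compact) auto
    show "eri_star \<in> M"
      unfolding M_def using eri_star_notin_image[OF nonzero]
      by (auto simp: eri_carrier_eq eri_star_def)
    show "\<not> U n \<subseteq> M" for n
      using t(3)[of n] by (auto simp: M_def)
  qed
qed

lemma eri_star_no_countable_neighbourhood_base:
  assumes "countable \<B>"
  shows "\<not> neighbourhood_base_in eri_space eri_star \<B>"
proof
  assume base: "neighbourhood_base_in eri_space eri_star \<B>"
  \<comment> \<open>The whole space is a neighbourhood, so the base is nonempty and can be
    enumerated, possibly with repetitions.\<close>
  have "eri_carrier \<in> Collect eri_open"
    using openin_topspace[of eri_space] by (simp add: openin_eri_space topspace_eri_space)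
  then have "neighbourhood_in eri_space eri_star eri_carrier"
    by (auto simp: neighbourhood_in_def openin_eri_space topspace_eri_space
        eri_carrier_eq eri_star_def)
  then have "\<B> \<noteq> {}"
    using base by (auto simp: neighbourhood_base_in_def)
  then obtain N :: "nat \<Rightarrow> ereal set set" where N: "\<B> = range N"
    using uncountable_def[of \<B>] assms by auto
  \<comment> \<open>Base members need not be open; a set that contains no \<open>U n\<close>
    contains no \<open>N n\<close> either.\<close>
  then have "\<forall>n. \<exists>U. eri_open U \<and> eri_star \<in> U \<and> U \<subseteq> N n"
    using base by (auto simp: neighbourhood_base_in_def neighbourhood_in_def openin_eri_space)
  then obtain U where U: "\<And>n. eri_open (U n)" "\<And>n. eri_star \<in> U n" "\<And>n. U n \<subseteq> N n"
    by metis
  obtain M where M: "eri_open M" "eri_star \<in> M" "\<And>n. \<not> U n \<subseteq> M"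
    using eri_open_star_containing_no_member[of U] U by metis
  then have "neighbourhood_in eri_space eri_star M"
    by (auto simp: neighbourhood_in_def openin_eri_space topspace_eri_space eri_open_def)
  then obtain n where "N n \<subseteq> M"
    using base N by (auto simp: neighbourhood_base_in_def)
  with U(3) M(3) show False by blast
qed

text \<open>The family given by \<open>first_countable\<close> may include open sets that miss
  \<open>x\<close>; discarding them leaves a neighbourhood base.\<close>

lemma first_countable_imp_countable_neighbourhood_base:
  assumes "first_countable X" "x \<in> topspace X"
  obtains \<B> where "countable \<B>" "neighbourhood_base_in X x \<B>"
proof -
  obtain \<C> where \<C>: "countable \<C>" "\<And>V. V \<in> \<C> \<Longrightarrow> openin X V"
      "\<And>U. openin X U \<Longrightarrow> x \<in> U \<Longrightarrow> \<exists>V\<in>\<C>. x \<in> V \<and> V \<subseteq> U"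
    using assms unfolding first_countable_def by metis
  show thesis
  proof
    show "countable {V \<in> \<C>. x \<in> V}"
      using \<C>(1) by (rule countable_subset[rotated]) auto
    show "neighbourhood_base_in X x {V \<in> \<C>. x \<in> V}"
      unfolding neighbourhood_base_in_def neighbourhood_in_def
    proof (intro conjI ballI allI impI)
      fix V assume "V \<in> {V \<in> \<C>. x \<in> V}"
      then show "V \<subseteq> topspace X" "\<exists>U. openin X U \<and> x \<in> U \<and> U \<subseteq> V"
        using \<C>(2) openin_subset by blast+
    next
      fix M assume "M \<subseteq> topspace X \<and> (\<exists>U. openin X U \<and> x \<in> U \<and> U \<subseteq> M)"
      then obtain U where "openin X U" "x \<in> U" "U \<subseteq> M" by blast
      with \<C>(3)[of U] show "\<exists>N\<in>{V \<in> \<C>. x \<in> V}. N \<subseteq> M" by blast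
    qed
  qed
qed

theorem proposition3p1:
  shows "\<not> (\<exists>\<B>. countable \<B> \<and> neighbourhood_base_in eri_space eri_star \<B>)
    \<and> \<not> first_countable eri_space
    \<and> \<not> second_countable eri_space"
proof -
  have "eri_star \<in> topspace eri_space"
    by (auto simp: topspace_eri_space eri_carrier_eq eri_star_def)
  then have "\<not> first_countable eri_space"
    using first_countable_imp_countable_neighbourhood_base eri_star_no_countable_neighbourhood_base
    by metis
  then show ?thesis
    using eri_star_no_countable_neighbourhood_base second_countable_imp_first_countable by blast
qed

end
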